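(* Let $k$ and $n$ be integers with $k\geq 2$ and $n\geq 15k-24$. Then the Kneser graph $K(n,k)$ is not semi-transitive.
   Context: For integers $k\geq 1$ and $n\geq k$, the Kneser graph $K(n,k)$ is the simple undirected graph whose vertices are the $k$-element subsets of $[n]=\{1,2,\ldots,n\}$, where two distinct vertices are adjacent if and only if the corresponding subsets are disjoint. An orientation of a simple undirected graph (a choice of exactly one direction for each edge) is semi-transitive if it is acyclic (has no directed cycles) and, for any directed path $v_0\rightarrow v_1\rightarrow\cdots\rightarrow v_k$, either there is no edge between $v_0$ and $v_k$, or $v_i\rightarrow v_j$ is an edge for all $0\leq i<j\leq k$ (here $k$ denotes the length of the path). An undirected graph is semi-transitive if it admits a semi-transitive orientation. *)

theory Defs
  imports "Graph_Theory.Graph_Theory"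
begin

text \<open>
  A simple undirected graph is represented, as in the locale \<^locale>\<open>pair_graph\<close>, by a symmetric
  loop-free digraph without parallel arcs: an edge between \<open>u\<close> and \<open>v\<close> is the pair of arcs
  \<open>(u, v)\<close> and \<open>(v, u)\<close>.
\<close>

definition kneser_graph :: "nat \<Rightarrow> nat \<Rightarrow> nat set pair_pre_digraph" where
  "kneser_graph n k =
    (let V = {S. S \<subseteq> {1..n} \<and> card S = k}
     in \<lparr> pverts = V, parcs = {(A, B). A \<in> V \<and> B \<in> V \<and> A \<noteq> B \<and> A \<inter> B = {}} \<rparr>)"

lemma pverts_kneser_graph_iff:
  "S \<in> pverts (kneser_graph n k) \<longleftrightarrow> S \<subseteq> {1..n} \<and> card S = k"
  unfolding kneser_graph_def Let_def by simp

lemma parcs_kneser_graph_iff: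
  "(A, B) \<in> parcs (kneser_graph n k) \<longleftrightarrow>
    A \<in> pverts (kneser_graph n k) \<and> B \<in> pverts (kneser_graph n k) \<and> A \<noteq> B \<and> A \<inter> B = {}"
  unfolding kneser_graph_def Let_def by simp

lemma pair_graph_kneser_graph: "pair_graph (kneser_graph n k)"
proof -
  let ?G = "kneser_graph n k"
  have arcs: "fst e \<in> pverts ?G" "snd e \<in> pverts ?G" "fst e \<noteq> snd e" if "e \<in> parcs ?G" for e
    using that parcs_kneser_graph_iff[of "fst e" "snd e" n k] by simp_all
  have "pverts ?G \<subseteq> Pow {1..n}"
    using pverts_kneser_graph_iff by blast
  then have fin: "finite (pverts ?G)"
    by (rule finite_subset) simp
  have "parcs ?G \<subseteq> pverts ?G \<times> pverts ?G"
    using arcs(1,2) by (metis mem_Times_iff subsetI)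
  then have fin_arcs: "finite (parcs ?G)"
    using fin by (meson finite_SigmaI finite_subset)
  have sym: "symmetric (with_proj ?G)"
    unfolding symmetric_def with_proj_simps
    by (rule symI) (metis parcs_kneser_graph_iff inf_commute)
  show ?thesis
    by unfold_locales (fact arcs fin fin_arcs sym)+
qed

definition orientation_of :: "'a pair_pre_digraph \<Rightarrow> 'a pair_pre_digraph \<Rightarrow> bool" where
  "orientation_of G D \<longleftrightarrow>
    pverts D = pverts G \<and> parcs D \<subseteq> parcs G \<and>
    (\<forall>(u, v) \<in> parcs G. ((u, v) \<in> parcs D) \<noteq> ((v, u) \<in> parcs D))"

text \<open>
  A directed path \<open>v\<^sub>0 \<rightarrow> \<dots> \<rightarrow> v\<^sub>m\<close> is the list \<open>p\<close> of its (distinct) vertices, so that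
  \<open>v\<^sub>0 = hd p\<close> and \<open>v\<^sub>m = last p\<close>.  Adjacency of the two ends is adjacency in the undirected
  graph \<open>G\<close>, whereas the arcs \<open>v\<^sub>i \<rightarrow> v\<^sub>j\<close> are arcs of the orientation \<open>D\<close>.
\<close>

definition semi_transitive_orientation :: "'a pair_pre_digraph \<Rightarrow> 'a pair_pre_digraph \<Rightarrow> bool" where
  "semi_transitive_orientation G D \<longleftrightarrow>
    orientation_of G D \<and>
    (\<nexists>c. pre_digraph.cycle (with_proj D) c) \<and>
    (\<forall>p. vpath p (with_proj D) \<longrightarrow>
      (hd p, last p) \<notin> parcs G \<or>
      (\<forall>i j. i < j \<and> j < length p \<longrightarrow> (p ! i, p ! j) \<in> parcs D))"

definition semi_transitive :: "'a pair_pre_digraph \<Rightarrow> bool" where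
  "semi_transitive G \<longleftrightarrow> (\<exists>D. semi_transitive_orientation G D)"

end

theory Submission
  imports Defs
begin

text \<open>
  Give every edge \<open>uv\<close> of an oriented graph the sign \<open>s u v = 1\<close> if it is directed from \<open>u\<close> to \<open>v\<close>,
  and \<open>s u v = -1\<close> otherwise.  If the orientation is semi-transitive, no induced 4-cycle contains a
  directed path with three edges, so each induced 4-cycle has two edges in each direction and its
  signs sum to \<open>0\<close>.  Equivalently, when \<open>a\<close>, \<open>c\<close> are non-adjacent, the difference \<open>s a w - s c w\<close>
  does not change if the common neighbour \<open>w\<close> is replaced by another one that is not adjacent
  to \<open>w\<close> (lemma \<open>sign_exchange\<close>).

  In \<open>K(6,2)\<close> this forces the signs around the triangle \<open>12, 34, 56\<close> to sum to \<open>0\<close>, because twice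
  that triangle is an integral combination of eight induced 4-cycles.  But a sum of three signs is
  odd.  Hence no graph that contains \<open>K(6,2)\<close> as an induced subgraph is semi-transitive.

  Finally \<open>K(6,2)\<close> is an induced subgraph of \<open>K(n,k)\<close> as soon as \<open>n \<ge> 4k - 2\<close>: the graph
  \<open>K(6,2)\<close> has a proper colouring with four colours, and each 2-set is enlarged by \<open>k - 2\<close> new
  elements that depend only on its colour.  Two 2-sets of the same colour meet already, so
  sharing the new elements creates no wrong intersections.  The bound \<open>15k - 24\<close>, which corresponds
  to enlarging all fifteen 2-sets by pairwise disjoint sets, is never smaller than \<open>4k - 2\<close>.
\<close>

section \<open>Signs of edges and induced 4-cycles\<close>

definition arc_sign :: "'a pair_pre_digraph \<Rightarrow> 'a \<Rightarrow> 'a \<Rightarrow> int" where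
  "arc_sign D u v = (if (u, v) \<in> parcs D then 1 else -1)"

lemma arc_sign_swap:
  assumes "orientation_of G D" and "(u, v) \<in> parcs G"
  shows "arc_sign D v u = - arc_sign D u v"
  using assms unfolding orientation_of_def arc_sign_def by auto

lemma odd_arc_sign: "odd (arc_sign D u v)"
  unfolding arc_sign_def by simp

text \<open>
  A directed path \<open>a \<rightarrow> b \<rightarrow> c \<rightarrow> d\<close> with adjacent ends would need the chord \<open>a \<rightarrow> c\<close>.
\<close>

lemma no_directed_path_without_chord:
  assumes G: "pair_graph G" and D: "semi_transitive_orientation G D"
    and path: "(a, b) \<in> parcs D" "(b, c) \<in> parcs D" "(c, d) \<in> parcs D"
    and ends: "(a, d) \<in> parcs G" and chord: "(a, c) \<notin> parcs G"
  shows False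
proof -
  interpret pair_graph G by (fact G)
  have verts: "pverts D = pverts G" and arcs: "parcs D \<subseteq> parcs G"
    and one: "\<And>u v. (u, v) \<in> parcs G \<Longrightarrow> ((u, v) \<in> parcs D) \<noteq> ((v, u) \<in> parcs D)"
    using D unfolding semi_transitive_orientation_def orientation_of_def by auto
  have "distinct [a, b, c, d]"
    using path arcs one[of a b] one[of b c] one[of c d] one[of a d] ends by auto
  moreover have "set [a, b, c, d] \<subseteq> pverts D"
    using path arcs verts in_arcsD1 in_arcsD2 by auto
  ultimately have "vpath [a, b, c, d] (with_proj D)"
    using path by (simp add: vpath_def vwalk_def)
  moreover have "(hd [a, b, c, d], last [a, b, c, d]) \<in> parcs G"
    using ends by simp
  ultimately have "\<forall>i j. i < j \<and> j < length [a, b, c, d]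
      \<longrightarrow> ([a, b, c, d] ! i, [a, b, c, d] ! j) \<in> parcs D"
    using D unfolding semi_transitive_orientation_def by blast
  from this[rule_format, of 0 2] have "(a, c) \<in> parcs D"
    by simp
  then show False
    using arcs chord by blast
qed

text \<open>
  The signs around the induced 4-cycle \<open>a, b, c, d\<close> sum to \<open>0\<close>: otherwise at least three of its
  edges have the same direction, and three such edges are always consecutive on the cycle.  The
  equation is arranged so that each side compares \<open>a\<close> with \<open>c\<close> as seen from one common neighbour.
\<close>

lemma sign_exchange:
  assumes G: "pair_graph G" and D: "semi_transitive_orientation G D"
    and edges: "(a, b) \<in> parcs G" "(c, b) \<in> parcs G" "(a, d) \<in> parcs G" "(c, d) \<in> parcs G"
    and chords: "(a, c) \<notin> parcs G" "(b, d) \<notin> parcs G"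
  shows "arc_sign D a b - arc_sign D c b = arc_sign D a d - arc_sign D c d"
proof -
  interpret pair_graph G by (fact G)
  have sym: "(u, v) \<in> parcs G \<Longrightarrow> (v, u) \<in> parcs G" for u v
    by (rule arcs_symmetric)
  have one: "(u, v) \<in> parcs G \<Longrightarrow> ((u, v) \<in> parcs D) \<noteq> ((v, u) \<in> parcs D)" for u v
    using D unfolding semi_transitive_orientation_def orientation_of_def by auto
  note flip = one[OF edges(1)] one[OF edges(2)] one[OF edges(3)] one[OF edges(4)]
  note edges' = edges edges[THEN sym]
  have chords': "(c, a) \<notin> parcs G" "(d, b) \<notin> parcs G"
    using chords sym by blast+
  note no_path = no_directed_path_without_chord[OF G D]
  have
    "\<not> ((a, b) \<in> parcs D \<and> (b, c) \<in> parcs D \<and> (c, d) \<in> parcs D)"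
    "\<not> ((b, c) \<in> parcs D \<and> (c, d) \<in> parcs D \<and> (d, a) \<in> parcs D)"
    "\<not> ((c, d) \<in> parcs D \<and> (d, a) \<in> parcs D \<and> (a, b) \<in> parcs D)"
    "\<not> ((d, a) \<in> parcs D \<and> (a, b) \<in> parcs D \<and> (b, c) \<in> parcs D)"
    "\<not> ((a, d) \<in> parcs D \<and> (d, c) \<in> parcs D \<and> (c, b) \<in> parcs D)"
    "\<not> ((d, c) \<in> parcs D \<and> (c, b) \<in> parcs D \<and> (b, a) \<in> parcs D)"
    "\<not> ((c, b) \<in> parcs D \<and> (b, a) \<in> parcs D \<and> (a, d) \<in> parcs D)"
    "\<not> ((b, a) \<in> parcs D \<and> (a, d) \<in> parcs D \<and> (d, c) \<in> parcs D)"
    using no_path edges' chords chords' by blast+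
  with flip show ?thesis
    unfolding arc_sign_def by (auto split: if_splits)
qed

section \<open>Graphs with an induced copy of the Kneser graph of the 2-subsets of a 6-set\<close>

text \<open>
  Write \<open>s u v\<close> for the sign of the edge between the copies of \<open>u\<close> and \<open>v\<close>.  Twice the sum of the
  signs around the triangle \<open>12, 34, 56\<close> is the sum of the three differences
  \<open>s 12 w - s 56 w\<close> for \<open>w = 34\<close>, \<open>s 34 w - s 12 w\<close> for \<open>w = 56\<close> and \<open>s 56 w - s 34 w\<close> for \<open>w = 12\<close>.
  Each is split at one of the 2-subsets of \<open>{1, 3, 5}\<close>, so that the 2-sets compared run through the
  closed walk \<open>12, 15, 56, 35, 34, 13\<close> in which consecutive sets meet.  By exchanges, the two
  differences at the star of \<open>1\<close> can be seen from the same neighbour \<open>46\<close>, and likewise \<open>24\<close> for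
  the star of \<open>5\<close> and \<open>26\<close> for the star of \<open>3\<close>.  What remains are differences of the 2-subsets of
  \<open>{1, 3, 5}\<close>, all of which can be seen from \<open>24\<close>, where they cancel.
\<close>

lemma not_semi_transitive_if_induced_kneser_graph_6_2:
  fixes G :: "'a pair_pre_digraph"
  assumes G: "pair_graph G"
    and induced: "\<And>S T. S \<in> pverts (kneser_graph 6 2) \<Longrightarrow> T \<in> pverts (kneser_graph 6 2) \<Longrightarrow>
      (f S, f T) \<in> parcs G \<longleftrightarrow> (S, T) \<in> parcs (kneser_graph 6 2)"
  shows "\<not> semi_transitive G"
proof
  assume "semi_transitive G"
  then obtain D where D: "semi_transitive_orientation G D"
    unfolding semi_transitive_def by blast
  then have orient: "orientation_of G D"
    unfolding semi_transitive_orientation_def by blast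
  define V :: "nat set set" where "V = pverts (kneser_graph 6 2)"
  define s where "s S T = arc_sign D (f S) (f T)" for S T
  have V_iff: "S \<in> V \<longleftrightarrow> S \<subseteq> {1..6} \<and> card S = 2" for S
    unfolding V_def by (rule pverts_kneser_graph_iff)
  have adj: "(f S, f T) \<in> parcs G \<longleftrightarrow> S \<inter> T = {}" if "S \<in> V" "T \<in> V" for S T
    using that induced[of S T] V_iff[of S]
    unfolding V_def parcs_kneser_graph_iff by auto
  have swap: "s T S = - s S T" if "S \<in> V" "T \<in> V" "S \<inter> T = {}" for S T
    unfolding s_def using arc_sign_swap[OF orient] adj that by blast
  have exchange: "s A W - s B W = s A X - s B X"
    if "{A, B, W, X} \<subseteq> V" "A \<inter> B \<noteq> {}" "W \<inter> X \<noteq> {}"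
      "A \<inter> W = {}" "B \<inter> W = {}" "A \<inter> X = {}" "B \<inter> X = {}" for A B W X
    unfolding s_def by (rule sign_exchange[OF G D]) (use that adj in auto)
  have in_V: "{{1,2}, {3,4}, {5,6}, {1,3}, {1,5}, {3,5}, {2,4}, {2,6}, {4,6}} \<subseteq> V"
    by (simp add: V_iff)
  have star_1:
    "s {1,2} {3,4} - s {1,5} {3,4} = s {1,2} {4,6} - s {1,5} {4,6}"
    "s {1,3} {5,6} - s {1,2} {5,6} = s {1,3} {4,6} - s {1,2} {4,6}"
    using in_V by (intro exchange; simp)+
  have star_5:
    "s {1,5} {3,4} - s {5,6} {3,4} = s {1,5} {2,4} - s {5,6} {2,4}"
    "s {5,6} {1,2} - s {3,5} {1,2} = s {5,6} {2,4} - s {3,5} {2,4}"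
    using in_V by (intro exchange; simp)+
  have star_3:
    "s {3,5} {1,2} - s {3,4} {1,2} = s {3,5} {2,6} - s {3,4} {2,6}"
    "s {3,4} {5,6} - s {1,3} {5,6} = s {3,4} {2,6} - s {1,3} {2,6}"
    using in_V by (intro exchange; simp)+
  have inner:
    "s {1,3} {4,6} - s {1,5} {4,6} = s {1,3} {2,4} - s {1,5} {2,4}"
    "s {3,5} {2,6} - s {1,3} {2,6} = s {3,5} {2,4} - s {1,3} {2,4}"
    using in_V by (intro exchange; simp)+
  have turn: "s {3,4} {1,2} = - s {1,2} {3,4}" "s {5,6} {3,4} = - s {3,4} {5,6}"
    "s {1,2} {5,6} = - s {5,6} {1,2}"
    using in_V by (intro swap; simp)+
  have "s {1,2} {3,4} + s {3,4} {5,6} + s {5,6} {1,2} = 0"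
    using star_1 star_5 star_3 inner turn by linarith
  moreover have "odd (s {1,2} {3,4} + s {3,4} {5,6} + s {5,6} {1,2})"
    unfolding s_def by (simp add: odd_arc_sign)
  ultimately show False
    by simp
qed

section \<open>Enlarging the 2-sets\<close>

text \<open>
  The colour of a 2-subset of \<open>{1..6}\<close> is its least element, cut off at 4.  Sets of colour \<open>c < 4\<close>
  share the element \<open>c\<close>, and those of colour 4 lie in \<open>{4, 5, 6}\<close>.
\<close>

lemma disjoint_pairs_have_distinct_colours:
  fixes S T :: "nat set"
  assumes S: "S \<subseteq> {1..6}" "card S = 2" and T: "T \<subseteq> {1..6}" "card T = 2"
    and disjoint: "S \<inter> T = {}"
  shows "min 4 (Min S) \<noteq> min 4 (Min T)"
proof
  assume same: "min 4 (Min S) = min 4 (Min T)"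
  have fin: "finite S" "finite T"
    using S T finite_subset by blast+
  have ne: "S \<noteq> {}" "T \<noteq> {}"
    using S T by auto
  have "Min S \<noteq> Min T"
    using disjoint Min_in[OF fin(1) ne(1)] Min_in[OF fin(2) ne(2)] by auto
  with same have "4 \<le> Min S" "4 \<le> Min T"
    by (auto simp: min_def split: if_splits)
  then have "\<forall>x \<in> S \<union> T. 4 \<le> x"
    using fin ne by auto
  then have "S \<union> T \<subseteq> {4..6}"
    using S T by fastforce
  then have "card (S \<union> T) \<le> 3"
    using card_mono[of "{4..6::nat}" "S \<union> T"] by simp
  moreover have "card (S \<union> T) = 4"
    using card_Un_disjoint[OF fin disjoint] S T by simp
  ultimately show False
    by simp
qed

theorem kneser_graph_not_semi_transitive:
  fixes n k :: nat
  assumes "k \<ge> 2" and "n \<ge> 4 * k - 2"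
  shows "\<not> semi_transitive (kneser_graph n k)"
proof -
  obtain m where k: "k = m + 2"
    using \<open>k \<ge> 2\<close> by (metis add.commute le_Suc_ex)
  have n: "4 * m + 6 \<le> n"
    using assms k by simp
  define block where "block c = {6 + (c - 1) * m <.. 6 + c * m}" for c :: nat
  define colour where "colour S = min 4 (Min S)" for S :: "nat set"
  define f where "f S = S \<union> block (colour S)" for S
  have card_block: "card (block c) = m" if "1 \<le> c" for c
    using that by (cases c) (simp_all add: block_def)
  have block_above: "block c \<inter> {1..6} = {}" for c
    by (auto simp: block_def)
  have block_less: "block c \<inter> block d = {}" if "c < d" for c d
  proof -
    have "c * m \<le> (d - 1) * m"
      using that by (intro mult_right_mono) auto
    then show ?thesis
      by (auto simp: block_def)
  qed
  then have block_disjoint: "block c \<inter> block d = {}" if "c \<noteq> d" for c d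
    using that by (metis inf_commute nat_neq_iff)
  have block_subset: "block c \<subseteq> {1..n}" if "c \<le> 4" for c
  proof -
    have "c * m \<le> 4 * m"
      using that by (rule mult_right_mono) simp
    then have "6 + c * m \<le> n"
      using n by linarith
    then show ?thesis
      unfolding block_def by fastforce
  qed
  have f_vertex: "f S \<in> pverts (kneser_graph n k)" if S: "S \<subseteq> {1..6}" "card S = 2" for S
  proof -
    have fin: "finite S" and ne: "S \<noteq> {}"
      using S finite_subset by auto
    have "1 \<le> colour S" "colour S \<le> 4"
      using S Min_in[OF fin ne] by (auto simp: colour_def)
    moreover have "S \<inter> block (colour S) = {}"
      using S block_above by blast
    moreover have "S \<subseteq> {1..n}"
      using S n by force
    ultimately show ?thesis
      unfolding pverts_kneser_graph_iff f_def
      using S fin block_subset card_block k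
      by (simp add: card_Un_disjoint block_def)
  qed
  have f_disjoint: "f S \<inter> f T = {} \<longleftrightarrow> S \<inter> T = {}"
    if "S \<subseteq> {1..6}" "card S = 2" "T \<subseteq> {1..6}" "card T = 2" for S T
  proof
    assume "S \<inter> T = {}"
    then have "block (colour S) \<inter> block (colour T) = {}"
      unfolding colour_def
      by (intro block_disjoint disjoint_pairs_have_distinct_colours that)
    moreover have "S \<inter> block (colour T) = {}" "block (colour S) \<inter> T = {}"
      using that block_above by blast+
    ultimately show "f S \<inter> f T = {}"
      using \<open>S \<inter> T = {}\<close> unfolding f_def by blast
  qed (auto simp: f_def)
  show ?thesis
  proof (rule not_semi_transitive_if_induced_kneser_graph_6_2[OF pair_graph_kneser_graph])
    fix S T
    assume "S \<in> pverts (kneser_graph 6 2)" "T \<in> pverts (kneser_graph 6 2)"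
    then have ST: "S \<subseteq> {1..6}" "card S = 2" "T \<subseteq> {1..6}" "card T = 2"
      by (simp_all add: pverts_kneser_graph_iff)
    then have "S \<noteq> {}" "f S \<noteq> {}"
      by (auto simp: f_def)
    then show "(f S, f T) \<in> parcs (kneser_graph n k) \<longleftrightarrow> (S, T) \<in> parcs (kneser_graph 6 2)"
      using ST f_vertex f_disjoint[OF ST]
      by (auto simp: parcs_kneser_graph_iff pverts_kneser_graph_iff)
  qed
qed

theorem theorem13:
  fixes n k :: nat
  assumes "k \<ge> 2" and "n \<ge> 15 * k - 24"
  shows "\<not> semi_transitive (kneser_graph n k)"
  using assms by (intro kneser_graph_not_semi_transitive) auto

end
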